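(* Let $d,n\ge 1$ be integers, let $\alpha>0$, let $X=(x_1,\dots,x_n)$ with $x_1,\dots,x_n\in\mathbb{R}^d$ pairwise distinct, and let $Y=(y_1,\dots,y_n)^{\mathsf T}\in\mathbb{R}^n$. Suppose that $Y\neq 0$ and $\alpha<d$. Then there is no function $\phi^*\in\mathcal{A}_{X,Y}$ satisfying $$\phi^*\in\arg\min_{\phi\in\mathcal{A}_{X,Y}}\big\|\mathcal{F}^{-1}[\phi]\big\|_{H^{\alpha/2}}^2 .$$
   Context: The Fourier transform convention is $\mathcal{F}[g](\xi)=\int_{\mathbb{R}^d}g(x)e^{-2\pi i\,\xi^{\mathsf T}x}\,dx$ and $g(x)=\int_{\mathbb{R}^d}\mathcal{F}[g](\xi)e^{2\pi i\,x^{\mathsf T}\xi}\,d\xi$. Write $\langle\xi\rangle=(1+\|\xi\|^2)^{1/2}$ with $\|\cdot\|$ the Euclidean norm. For $\phi\in L^2(\mathbb{R}^d)$ (complex-valued), set $$\big\|\mathcal{F}^{-1}[\phi]\big\|_{H^{\alpha/2}}=\Big(\int_{\mathbb{R}^d}\langle\xi\rangle^{\alpha}|\phi(\xi)|^2\,d\xi\Big)^{1/2}\in[0,\infty].$$ For $X=(x_1,\dots,x_n)$ and $\phi\in L^1(\mathbb{R}^d)\cap L^2(\mathbb{R}^d)$, set $$\mathcal{P}_X\phi=\Big(\int_{\mathbb{R}^d}\phi(\xi)e^{2\pi i\,\xi\cdot x_1}\,d\xi,\ \dots,\ \int_{\mathbb{R}^d}\phi(\xi)e^{2\pi i\,\xi\cdot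 x_n}\,d\xi\Big)^{\mathsf T}.$$ The admissible class is $\mathcal{A}_{X,Y}=\{\phi\in L^1(\mathbb{R}^d)\cap L^2(\mathbb{R}^d)\mid \mathcal{P}_X\phi=Y\}$, where $Y\in\mathbb{R}^n$ is regarded as an element of $\mathbb{C}^n$. *)

theory Defs
  imports "HOL-Analysis.Analysis"
begin

text \<open>
  Elements of \<open>L\<^sup>p\<close> are represented by Lebesgue measurable functions, not by classes modulo
  equality almost everywhere; everything below depends only on the class.
\<close>

definition L1_functions :: "(real ^ 'd \<Rightarrow> complex) set" where
  "L1_functions = {\<phi>. integrable lebesgue \<phi>}"

definition L2_functions :: "(real ^ 'd \<Rightarrow> complex) set" where
  "L2_functions =
     {\<phi>. \<phi> \<in> borel_measurable lebesgue \<and> integrable lebesgue (\<lambda>\<xi>. (norm (\<phi> \<xi>))\<^sup>2)}"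

definition japanese_bracket :: "real ^ 'd \<Rightarrow> real" where
  "japanese_bracket \<xi> = sqrt (1 + (norm \<xi>)\<^sup>2)"

text \<open>The square root on \<open>[0, \<infinity>]\<close>, with value \<open>\<infinity>\<close> at \<open>\<infinity>\<close>.\<close>

definition ennsqrt :: "ennreal \<Rightarrow> ennreal" where
  "ennsqrt t = (if t = \<infinity> then \<infinity> else ennreal (sqrt (enn2real t)))"

text \<open>
  \<open>sobolev_norm s \<phi>\<close> is the \<open>H\<^sup>s\<close> norm of the inverse Fourier transform of \<open>\<phi>\<close>: the argument is
  the function on the frequency side, and the weight is the power \<open>2 * s\<close> of the bracket.
\<close>

definition sobolev_norm :: "real \<Rightarrow> (real ^ 'd \<Rightarrow> complex) \<Rightarrow> ennreal" where
  "sobolev_norm s \<phi> =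
     ennsqrt (\<integral>\<^sup>+\<xi>. ennreal (japanese_bracket \<xi> powr (2 * s) * (norm (\<phi> \<xi>))\<^sup>2) \<partial>lebesgue)"

definition sampling :: "('n \<Rightarrow> real ^ 'd) \<Rightarrow> (real ^ 'd \<Rightarrow> complex) \<Rightarrow> complex ^ 'n" where
  "sampling X \<phi> =
     (\<chi> i. \<integral>\<xi>. \<phi> \<xi> * exp (2 * complex_of_real pi * \<i> * complex_of_real (\<xi> \<bullet> X i)) \<partial>lebesgue)"

definition admissible :: "('n \<Rightarrow> real ^ 'd) \<Rightarrow> real ^ 'n \<Rightarrow> (real ^ 'd \<Rightarrow> complex) set" where
  "admissible X Y =
     {\<phi> \<in> L1_functions \<inter> L2_functions. sampling X \<phi> = (\<chi> i. complex_of_real (Y $ i))}"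

end

theory Submission
  imports Defs "HOL-Real_Asymp.Real_Asymp"
begin

text \<open>
  Every admissible function has positive norm, because \<open>Y \<noteq> 0\<close>, so it suffices to interpolate
  with arbitrarily small norm. The normalised indicator of the ball of radius \<open>R\<close>, suitably modulated,
  is the transform of a function with value \<open>1\<close> at a chosen node. To make it vanish at another
  node \<open>a\<close>, multiply on the space side by \<open>(1 - e\<^bsup>2 \<pi> i u (x - a)\<^esup>) / 2\<close>, where \<open>u\<close> is chosen such
  that this factor is \<open>1\<close> at the chosen node; on the frequency side this averages two translates,
  which keeps the sup bound \<open>1 / vol(B\<^sub>R)\<close> and enlarges the support by an amount independent of \<open>R\<close>.
  The squared norm of the resulting interpolant is \<open>O(R\<^sup>\<alpha>\<^sup>-\<^sup>d)\<close>.
\<close>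

section \<open>Bounded functions supported in a ball and their inverse Fourier transforms\<close>

text \<open>Taken over \<open>lborel\<close>, where translation invariance and Borel measurability
  apply directly; \<open>sampling_lborel\<close> links it to \<open>sampling\<close>, which
  integrates over \<open>lebesgue\<close>.\<close>

definition inverse_fourier :: "('a::euclidean_space \<Rightarrow> complex) \<Rightarrow> 'a \<Rightarrow> complex" where
  "inverse_fourier \<psi> x = (\<integral>\<xi>. \<psi> \<xi> * cis (2 * pi * (\<xi> \<bullet> x)) \<partial>lborel)"

text \<open>Height \<open>C\<close> and support radius \<open>r\<close> are all that the norm
  estimate depends on. They are kept as separate parameters because creating a new zero leaves the
  height alone and only enlarges the radius.\<close>

definition bump :: "real \<Rightarrow> real \<Rightarrow> ('a::euclidean_space \<Rightarrow> complex) \<Rightarrow> bool" where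
  "bump C r \<psi> \<longleftrightarrow>
     \<psi> \<in> borel_measurable borel \<and> (\<forall>\<xi>. norm (\<psi> \<xi>) \<le> C * indicator (cball 0 r) \<xi>)"

lemma borel_measurable_cis [measurable]: "cis \<in> borel_measurable borel"
  by (intro borel_measurable_continuous_onI continuous_intros)

lemma bump_measurable [measurable_dest]: "bump C r \<psi> \<Longrightarrow> \<psi> \<in> borel_measurable borel"
  by (simp add: bump_def)

lemma bump_bound: "bump C r \<psi> \<Longrightarrow> norm (\<psi> \<xi>) \<le> C * indicator (cball 0 r) \<xi>"
  by (simp add: bump_def)

lemma bump_nonneg: "bump C r (\<psi> :: 'a::euclidean_space \<Rightarrow> complex) \<Longrightarrow> 0 \<le> r \<Longrightarrow> 0 \<le> C"
  using order_trans[OF norm_ge_zero bump_bound[of C r \<psi> 0]] by simp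

lemma bump_scale:
  assumes "bump C r \<psi>"
  shows "bump (norm c * C) r (\<lambda>\<xi>. c * \<psi> \<xi>)"
proof -
  have "norm c * norm (\<psi> \<xi>) \<le> norm c * (C * indicator (cball 0 r) \<xi>)" for \<xi>
    by (intro mult_left_mono bump_bound[OF assms]) auto
  then show ?thesis
    using assms by (auto simp: bump_def norm_mult mult.assoc)
qed

lemma bump_enlarge:
  assumes "bump C r \<psi>" "0 \<le> r" "r \<le> r'"
  shows "bump C r' \<psi>"
proof -
  have "C * indicator (cball 0 r) \<xi> \<le> C * (indicator (cball 0 r') \<xi> :: real)" for \<xi> :: 'a
    using assms bump_nonneg[OF assms(1,2)] by (auto simp: indicator_def)
  then show ?thesis
    using assms(1) order_trans unfolding bump_def by blast
qed

lemma bump_sum: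
  assumes "\<And>i. i \<in> I \<Longrightarrow> bump (C i) r (\<psi> i)"
  shows "bump (\<Sum>i\<in>I. C i) r (\<lambda>\<xi>. \<Sum>i\<in>I. \<psi> i \<xi>)"
  using assms unfolding bump_def
  by (auto simp: sum_distrib_right intro!: borel_measurable_sum sum_norm_le)

lemma bump_translate:
  assumes "bump C r \<psi>" "0 \<le> r"
  shows "bump C (r + norm u) (\<lambda>\<xi>. \<psi> (\<xi> - u))"
proof -
  have "norm (\<psi> (\<xi> - u)) \<le> C * indicator (cball 0 (r + norm u)) \<xi>" for \<xi>
  proof -
    have "norm \<xi> \<le> norm (\<xi> - u) + norm u"
      by (metis diff_add_cancel norm_triangle_ineq)
    then show ?thesis
      using bump_bound[OF assms(1), of "\<xi> - u"] bump_nonneg[OF assms]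
      by (cases "norm (\<xi> - u) \<le> r") auto
  qed
  moreover have "(\<lambda>\<xi>. \<psi> (\<xi> - u)) \<in> borel_measurable borel"
    using bump_measurable[OF assms(1)] by measurable
  ultimately show ?thesis
    by (simp add: bump_def)
qed

lemma integrable_cball_indicator:
  "integrable lborel (\<lambda>\<xi>::'a::euclidean_space. C * indicator (cball 0 r) \<xi> :: real)"
  using emeasure_lborel_cball_finite[of "0::'a" r]
  by (intro integrable_mult_right integrable_real_indicator) auto

lemma bump_integrable:
  assumes "bump C r \<psi>"
  shows "integrable lborel (\<lambda>\<xi>. \<psi> \<xi> * cis (2 * pi * (\<xi> \<bullet> x)))"
proof (rule Bochner_Integration.integrable_bound)
  show "integrable lborel (\<lambda>\<xi>. C * indicator (cball 0 r) \<xi> :: real)"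
    by (rule integrable_cball_indicator)
  note [measurable] = bump_measurable[OF assms]
  show "(\<lambda>\<xi>. \<psi> \<xi> * cis (2 * pi * (\<xi> \<bullet> x))) \<in> borel_measurable lborel"
    by measurable
  show "AE \<xi> in lborel. norm (\<psi> \<xi> * cis (2 * pi * (\<xi> \<bullet> x)))
          \<le> norm (C * indicator (cball 0 r) \<xi> :: real)"
    using bump_bound[OF assms] by (auto simp: norm_mult intro: order_trans[OF _ abs_ge_self])
qed

lemma inverse_fourier_scale: "inverse_fourier (\<lambda>\<xi>. c * \<psi> \<xi>) x = c * inverse_fourier \<psi> x"
  by (simp add: inverse_fourier_def mult.assoc)

lemma inverse_fourier_diff:
  assumes "bump C r \<psi>" "bump C' r' \<psi>'"
  shows "inverse_fourier (\<lambda>\<xi>. \<psi> \<xi> - \<psi>' \<xi>) x = inverse_fourier \<psi> x - inverse_fourier \<psi>' x"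
  using bump_integrable[OF assms(1)] bump_integrable[OF assms(2)]
  by (simp add: inverse_fourier_def left_diff_distrib)

lemma inverse_fourier_sum:
  assumes "\<And>i. i \<in> I \<Longrightarrow> bump (C i) (r i) (\<psi> i)"
  shows "inverse_fourier (\<lambda>\<xi>. \<Sum>i\<in>I. \<psi> i \<xi>) x = (\<Sum>i\<in>I. inverse_fourier (\<psi> i) x)"
  unfolding inverse_fourier_def sum_distrib_right
  using assms bump_integrable by (intro Bochner_Integration.integral_sum) blast

text \<open>\<open>lborel\<close> is its own image under translation by \<open>u\<close>, so \<xi>
  may be replaced by \<open>u + \<xi>\<close>, which splits a constant phase off the kernel.
  Multiplication by a character in space is thus realised without changing the height in
  frequency.\<close>

lemma inverse_fourier_translate:
  fixes \<psi> :: "'a::euclidean_space \<Rightarrow> complex"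
  assumes "bump C r \<psi>"
  shows "inverse_fourier (\<lambda>\<xi>. \<psi> (\<xi> - u)) x = cis (2 * pi * (u \<bullet> x)) * inverse_fourier \<psi> x"
proof -
  note [measurable] = bump_measurable[OF assms]
  have "(\<integral>\<xi>. \<psi> (\<xi> - u) * cis (2 * pi * (\<xi> \<bullet> x)) \<partial>lborel)
      = (\<integral>\<xi>. \<psi> (\<xi> - u) * cis (2 * pi * (\<xi> \<bullet> x)) \<partial>distr lborel borel ((+) u))"
    by (simp add: lborel_distr_plus)
  also have "\<dots> = (\<integral>\<xi>. \<psi> \<xi> * cis (2 * pi * ((u + \<xi>) \<bullet> x)) \<partial>lborel)"
    by (subst integral_distr) auto
  also have "\<dots> = (\<integral>\<xi>. cis (2 * pi * (u \<bullet> x)) * (\<psi> \<xi> * cis (2 * pi * (\<xi> \<bullet> x))) \<partial>lborel)"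
    by (intro Bochner_Integration.integral_cong refl)
       (simp add: inner_add_left distrib_left flip: cis_mult)
  also have "\<dots> = cis (2 * pi * (u \<bullet> x)) * (\<integral>\<xi>. \<psi> \<xi> * cis (2 * pi * (\<xi> \<bullet> x)) \<partial>lborel)"
    by simp
  finally show ?thesis
    by (simp add: inverse_fourier_def)
qed

section \<open>Interpolation by functions of small height\<close>

text \<open>Induction on \<open>A\<close>, each step adding one zero. \<open>K\<close> is chosen
  before \<open>R\<close>: it is the total length of the translations used, which depends on the
  nodes only, so the enlargement of the support is negligible as \<open>R\<close> grows.\<close>

lemma exists_node_bump:
  fixes x :: "'a::euclidean_space"
  assumes "finite A" "x \<notin> A"
  shows "\<exists>K\<ge>0. \<forall>R>0. \<exists>\<psi>. bump (1 / measure lborel (cball (0::'a) R)) (R + K) \<psi> \<and>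
           inverse_fourier \<psi> x = 1 \<and> (\<forall>a\<in>A. inverse_fourier \<psi> a = 0)"
  using assms
proof (induction A rule: finite_induct)
  case empty
  have "\<exists>\<psi>. bump (1 / measure lborel (cball (0::'a) R)) (R + 0) \<psi> \<and> inverse_fourier \<psi> x = 1"
    if "R > 0" for R
  proof -
    define v where "v = measure lborel (cball (0::'a) R)"
    have v: "v > 0"
      using that by (simp add: v_def content_cball_pos)
    define \<psi> :: "'a \<Rightarrow> complex" where
      \<comment> \<open>The phase cancels the Fourier kernel at \<open>x\<close>, leaving the
        integral of the normalised indicator.\<close>
      "\<psi> = (\<lambda>\<xi>. of_real (indicator (cball 0 R) \<xi> / v) * cis (- 2 * pi * (\<xi> \<bullet> x)))"
    have [measurable]: "cball (0::'a) R \<in> sets borel"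
      by simp
    have "\<psi> \<in> borel_measurable borel"
      unfolding \<psi>_def by measurable
    then have "bump (1 / v) R \<psi>"
      using v by (auto simp: bump_def \<psi>_def norm_mult indicator_def norm_divide)
    moreover have "inverse_fourier \<psi> x = 1"
    proof -
      have "\<psi> \<xi> * cis (2 * pi * (\<xi> \<bullet> x)) = complex_of_real (indicator (cball 0 R) \<xi> / v)" for \<xi>
        by (simp add: \<psi>_def mult.assoc cis_mult)
      then have "inverse_fourier \<psi> x = (\<integral>\<xi>. complex_of_real (indicator (cball (0::'a) R) \<xi> / v) \<partial>lborel)"
        by (simp only: inverse_fourier_def)
      also have "\<dots> = of_real (v / v)"
        unfolding integral_complex_of_real by (simp add: v_def)
      finally show ?thesis
        using v by simp
    qed
    ultimately show ?thesis
      by (auto simp: v_def)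
  qed
  then show ?case
    by (intro exI[of _ 0]) auto
next
  case (insert b A)
  then obtain K where K: "K \<ge> 0"
    "\<And>R. R > 0 \<Longrightarrow> \<exists>\<psi>. bump (1 / measure lborel (cball (0::'a) R)) (R + K) \<psi> \<and>
           inverse_fourier \<psi> x = 1 \<and> (\<forall>a\<in>A. inverse_fourier \<psi> a = 0)"
    by auto
  have "x \<noteq> b"
    using insert.prems by auto
  \<comment> \<open>The scaling makes the phase of
    \<open>cis (2 * pi * (u \<bullet> (y - b)))\<close> equal to \<open>pi\<close> at
    \<open>y = x\<close> and 0 at \<open>y = b\<close>. Hence half of 1 minus this number is 1 at
    \<open>x\<close> and 0 at \<open>b\<close>.\<close>
  define u where "u = (1 / (2 * (norm (x - b))\<^sup>2)) *\<^sub>R (x - b)"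
  have u: "u \<bullet> (x - b) = 1 / 2"
    using \<open>x \<noteq> b\<close> by (simp add: u_def flip: power2_norm_eq_inner)
  have "\<exists>\<psi>. bump (1 / measure lborel (cball (0::'a) R)) (R + (K + norm u)) \<psi> \<and>
          inverse_fourier \<psi> x = 1 \<and> (\<forall>a\<in>insert b A. inverse_fourier \<psi> a = 0)"
    if R: "R > 0" for R
  proof -
    define C where "C = 1 / measure lborel (cball (0::'a) R)"
    obtain \<psi> :: "'a \<Rightarrow> complex" where \<psi>: "bump C (R + K) \<psi>"
      "inverse_fourier \<psi> x = 1" "\<And>a. a \<in> A \<Longrightarrow> inverse_fourier \<psi> a = 0"
      using K(2)[OF R] by (auto simp: C_def)
    \<comment> \<open>Translation by \<open>u\<close> produces the character
      \<open>cis (2 * pi * (u \<bullet> y))\<close>; the factor \<open>- c\<close> recentres it at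
      \<open>b\<close>. Since \<open>- c\<close> has modulus 1, \<open>\<psi>'\<close> is half the
      difference of two functions bounded by \<open>C\<close>, so it is bounded by \<open>C\<close>
      too.\<close>
    define c where "c = - cis (- 2 * pi * (u \<bullet> b))"
    define \<psi>' where "\<psi>' = (\<lambda>\<xi>. (1 / 2) * (\<psi> \<xi> - (- c) * \<psi> (\<xi> - u)))"
    have trans: "bump C (R + K + norm u) (\<lambda>\<xi>. \<psi> (\<xi> - u))"
      using \<psi>(1) R K(1) by (intro bump_translate) auto
    have mod: "bump C (R + K + norm u) (\<lambda>\<xi>. (- c) * \<psi> (\<xi> - u))"
      using bump_scale[OF trans, of "- c"] by (simp add: c_def)
    have keep: "bump C (R + K + norm u) \<psi>"
      using R K(1) by (intro bump_enlarge[OF \<psi>(1)]) auto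
    have "bump C (R + K + norm u) \<psi>'"
    proof -
      have "norm (\<psi>' \<xi>) \<le> C * indicator (cball 0 (R + K + norm u)) \<xi>" for \<xi>
        using norm_triangle_ineq4[of "\<psi> \<xi>" "(- c) * \<psi> (\<xi> - u)"]
          bump_bound[OF keep, of \<xi>] bump_bound[OF mod, of \<xi>]
        by (simp add: \<psi>'_def norm_mult norm_divide)
      moreover have "\<psi>' \<in> borel_measurable borel"
        using bump_measurable[OF keep] bump_measurable[OF mod] unfolding \<psi>'_def
        by (intro borel_measurable_times borel_measurable_diff) auto
      ultimately show ?thesis
        by (simp add: bump_def)
    qed
    moreover have val: "inverse_fourier \<psi>' y
        = (1 / 2) * (1 - cis (2 * pi * (u \<bullet> (y - b)))) * inverse_fourier \<psi> y" for y
    proof -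
      have "cis (2 * pi * (u \<bullet> (y - b))) = - c * cis (2 * pi * (u \<bullet> y))"
        by (simp add: c_def cis_mult inner_diff_right right_diff_distrib)
      then show ?thesis
        unfolding \<psi>'_def inverse_fourier_scale inverse_fourier_diff[OF keep mod]
          inverse_fourier_translate[OF \<psi>(1)]
        by (simp only: left_diff_distrib right_diff_distrib mult.assoc mult_1_left)
    qed
    moreover have "inverse_fourier \<psi>' x = 1"
      by (simp add: val u \<psi>(2))
    \<comment> \<open>By \<open>val\<close> the new transform is a multiple of the old one, so the
      zeros on \<open>A\<close> survive, and the multiplier vanishes at \<open>b\<close>.\<close>
    moreover have "inverse_fourier \<psi>' a = 0" if "a \<in> insert b A" for a
      using that \<psi>(3) by (auto simp: val)
    ultimately show ?thesis
      by (auto simp: C_def add.assoc)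
  qed
  then show ?case
    using K(1) by (intro exI[of _ "K + norm u"]) auto
qed

text \<open>Lagrange interpolation: each node gets a bump equal to 1 there and 0 at the other nodes,
  and these are combined with coefficients \<open>y i\<close>. The sum of the individual constants
  \<open>K i\<close> provides a common support radius.\<close>

lemma exists_interpolating_bump:
  fixes X :: "'n::finite \<Rightarrow> 'a::euclidean_space" and y :: "'n \<Rightarrow> complex"
  assumes "inj X"
  shows "\<exists>K\<ge>0. \<forall>R>0. \<exists>\<psi>. bump ((\<Sum>i\<in>UNIV. norm (y i)) / measure lborel (cball (0::'a) R)) (R + K) \<psi> \<and>
           (\<forall>i. inverse_fourier \<psi> (X i) = y i)"
proof -
  have "\<exists>K\<ge>0. \<forall>R>0. \<exists>\<psi>. bump (1 / measure lborel (cball (0::'a) R)) (R + K) \<psi> \<and>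
      inverse_fourier \<psi> (X i) = 1 \<and> (\<forall>a\<in>X ` (- {i}). inverse_fourier \<psi> a = 0)" for i
    using assms by (intro exists_node_bump) (auto simp: inj_eq)
  then obtain K where K: "\<And>i. K i \<ge> 0"
    "\<And>i R. R > 0 \<Longrightarrow> \<exists>\<psi>. bump (1 / measure lborel (cball (0::'a) R)) (R + K i) \<psi> \<and>
      inverse_fourier \<psi> (X i) = 1 \<and> (\<forall>a\<in>X ` (- {i}). inverse_fourier \<psi> a = 0)"
    by metis
  have "\<exists>\<psi>. bump ((\<Sum>i\<in>UNIV. norm (y i)) / measure lborel (cball (0::'a) R)) (R + sum K UNIV) \<psi> \<and>
           (\<forall>i. inverse_fourier \<psi> (X i) = y i)" if R: "R > 0" for R
  proof -
    define C where "C = 1 / measure lborel (cball (0::'a) R)"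
    obtain \<psi> where "\<And>i. bump C (R + K i) (\<psi> i) \<and> inverse_fourier (\<psi> i) (X i) = 1 \<and>
        (\<forall>a\<in>X ` (- {i}). inverse_fourier (\<psi> i) a = 0)"
      using K(2)[OF R] unfolding C_def by metis
    then have \<psi>: "\<And>i. bump C (R + K i) (\<psi> i)" "\<And>i. inverse_fourier (\<psi> i) (X i) = 1"
      "\<And>i j. j \<noteq> i \<Longrightarrow> inverse_fourier (\<psi> i) (X j) = 0"
      by auto
    have b: "bump (norm (y i) * C) (R + sum K UNIV) (\<lambda>\<xi>. y i * \<psi> i \<xi>)" for i
      using K(1) R \<psi>(1)
      by (intro bump_scale bump_enlarge[OF \<psi>(1)]) (auto intro!: member_le_sum add_nonneg_nonneg)
    have "bump (\<Sum>i\<in>UNIV. norm (y i) * C) (R + sum K UNIV) (\<lambda>\<xi>. \<Sum>i\<in>UNIV. y i * \<psi> i \<xi>)"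
      using b by (intro bump_sum) auto
    moreover have "inverse_fourier (\<lambda>\<xi>. \<Sum>i\<in>UNIV. y i * \<psi> i \<xi>) (X j) = y j" for j
    proof -
      have "inverse_fourier (\<lambda>\<xi>. \<Sum>i\<in>UNIV. y i * \<psi> i \<xi>) (X j)
          = (\<Sum>i\<in>UNIV. y i * inverse_fourier (\<psi> i) (X j))"
        by (subst inverse_fourier_sum[OF b]) (simp add: inverse_fourier_scale)
      also have "\<dots> = (\<Sum>i\<in>UNIV. if i = j then y i else 0)"
        using \<psi>(2,3) by (intro sum.cong) auto
      finally show ?thesis
        by simp
    qed
    ultimately show ?thesis
      by (auto simp: C_def sum_divide_distrib intro!: exI[of _ "\<lambda>\<xi>. \<Sum>i\<in>UNIV. y i * \<psi> i \<xi>"])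
  qed
  then show ?thesis
    using K(1) by (intro exI[of _ "sum K UNIV"]) (auto intro: sum_nonneg)
qed

section \<open>Transfer to the admissible class and the Sobolev norm\<close>

text \<open>Valid at \<infinity> as well, so the squared norm is the weighted integral with no
  finiteness condition.\<close>

lemma ennsqrt_power2: "(ennsqrt t)\<^sup>2 = t"
proof (cases t)
  case (real r)
  then show ?thesis
    by (simp add: ennsqrt_def ennreal_power)
qed (simp add: ennsqrt_def ennreal_top_eq_mult_iff power2_eq_square)

text \<open>Completing the measure does not change the integral of a Borel function, and the two
  exponentials agree by Euler's formula.\<close>

lemma sampling_lborel:
  fixes \<psi> :: "real ^ 'd \<Rightarrow> complex"
  assumes "\<psi> \<in> borel_measurable borel"
  shows "sampling X \<psi> $ i = inverse_fourier \<psi> (X i)"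
proof -
  note [measurable] = assms
  have "exp (2 * complex_of_real pi * \<i> * complex_of_real t) = cis (2 * pi * t)" for t
    by (simp add: cis_conv_exp mult_ac)
  then have "sampling X \<psi> $ i = (\<integral>\<xi>. \<psi> \<xi> * cis (2 * pi * (\<xi> \<bullet> X i)) \<partial>lebesgue)"
    by (simp add: sampling_def)
  also have "\<dots> = (\<integral>\<xi>. \<psi> \<xi> * cis (2 * pi * (\<xi> \<bullet> X i)) \<partial>lborel)"
    by (rule integral_completion) measurable
  finally show ?thesis
    by (simp add: inverse_fourier_def)
qed

lemma bump_L1_L2:
  fixes \<psi> :: "real ^ 'd \<Rightarrow> complex"
  assumes "bump C r \<psi>"
  shows "\<psi> \<in> L1_functions \<inter> L2_functions"
proof -
  note [measurable] = bump_measurable[OF assms]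
  have "integrable lborel \<psi>"
    using bump_bound[OF assms]
    by (intro Bochner_Integration.integrable_bound[OF integrable_cball_indicator[of C r]]) (auto intro: order_trans[OF _ abs_ge_self])
  moreover have "integrable lborel (\<lambda>\<xi>. (norm (\<psi> \<xi>))\<^sup>2)"
  proof (rule Bochner_Integration.integrable_bound[OF integrable_cball_indicator[of "C\<^sup>2" r]])
    have "norm ((norm (\<psi> \<xi>))\<^sup>2) \<le> norm (C\<^sup>2 * indicator (cball 0 r) \<xi> :: real)" for \<xi>
      using power_mono[OF bump_bound[OF assms, of \<xi>] norm_ge_zero, of 2]
      by (cases "norm \<xi> \<le> r") auto
    then show "AE \<xi> in lborel. norm ((norm (\<psi> \<xi>))\<^sup>2) \<le> norm (C\<^sup>2 * indicator (cball 0 r) \<xi> :: real)"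
      by simp
  qed measurable
  ultimately show ?thesis
    by (simp add: L1_functions_def L2_functions_def integrable_completion measurable_completion)
qed

text \<open>On the support the weight is largest at the boundary, since \<open>0 \<le> s\<close>.
  The bound is this largest weight times the squared height times the volume of the ball.\<close>

lemma sobolev_norm_bump:
  fixes \<psi> :: "real ^ 'd \<Rightarrow> complex"
  assumes \<psi>: "bump C r \<psi>" and "0 \<le> s" "0 \<le> r"
  shows "(sobolev_norm s \<psi>)\<^sup>2
    \<le> ennreal ((1 + r\<^sup>2) powr s * C\<^sup>2 * measure lborel (cball (0 :: real ^ 'd) r))"
proof -
  have ptw: "japanese_bracket \<xi> powr (2 * s) * (norm (\<psi> \<xi>))\<^sup>2
      \<le> (1 + r\<^sup>2) powr s * C\<^sup>2 * indicator (cball 0 r) \<xi>" for \<xi>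
  proof (cases "norm \<xi> \<le> r")
    case True
    have "japanese_bracket \<xi> powr (2 * s) = (1 + (norm \<xi>)\<^sup>2) powr s"
      by (simp add: japanese_bracket_def powr_half_sqrt[symmetric] powr_powr add_nonneg_nonneg)
    also have "\<dots> \<le> (1 + r\<^sup>2) powr s"
      using True \<open>0 \<le> s\<close> by (intro powr_mono2 add_mono power_mono) auto
    finally have "japanese_bracket \<xi> powr (2 * s) \<le> (1 + r\<^sup>2) powr s" .
    moreover have "(norm (\<psi> \<xi>))\<^sup>2 \<le> C\<^sup>2"
      using bump_bound[OF \<psi>, of \<xi>] True by (intro power_mono) auto
    ultimately show ?thesis
      using True by (auto intro!: mult_mono)
  next
    case False
    then show ?thesis
      using bump_bound[OF \<psi>, of \<xi>] by simp
  qed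
  have "(sobolev_norm s \<psi>)\<^sup>2
      = (\<integral>\<^sup>+\<xi>. ennreal (japanese_bracket \<xi> powr (2 * s) * (norm (\<psi> \<xi>))\<^sup>2) \<partial>lborel)"
    by (simp add: sobolev_norm_def ennsqrt_power2 nn_integral_completion)
  also have "\<dots> \<le> (\<integral>\<^sup>+\<xi>. ennreal ((1 + r\<^sup>2) powr s * C\<^sup>2) * indicator (cball 0 r :: (real ^ 'd) set) \<xi> \<partial>lborel)"
    using ennreal_leI[OF ptw] by (intro nn_integral_mono) (simp add: ennreal_mult'' ennreal_indicator)
  also have "\<dots> = ennreal ((1 + r\<^sup>2) powr s * C\<^sup>2) * emeasure lborel (cball (0 :: real ^ 'd) r)"
    by (simp add: nn_integral_cmult_indicator)
  also have "\<dots> = ennreal ((1 + r\<^sup>2) powr s * C\<^sup>2 * measure lborel (cball (0 :: real ^ 'd) r))"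
    using emeasure_lborel_cball_finite[of "0 :: real ^ 'd" r]
    by (simp add: emeasure_eq_ennreal_measure ennreal_mult'')
  finally show ?thesis .
qed

section \<open>Decay of the norm bound for large radii\<close>

text \<open>With \<open>d\<close> the dimension, the weight grows like
  \<open>R powr \<alpha>\<close>, the squared height decays like \<open>R powr (- 2 * d)\<close> and
  the volume grows like \<open>R ^ d\<close>. The product has order
  \<open>R powr (\<alpha> - d)\<close>.\<close>

lemma bump_norm_bound_tendsto_0:
  assumes "\<alpha> < real DIM('a::euclidean_space)"
  shows "((\<lambda>R. (1 + (R + K)\<^sup>2) powr (\<alpha> / 2) * (C / measure lborel (cball (0::'a) R))\<^sup>2
            * measure lborel (cball (0::'a) (R + K))) \<longlongrightarrow> 0) at_top"
proof -
  define d where "d = DIM('a)"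
  define \<beta> where "\<beta> = unit_ball_vol (real d)"
  have \<beta>: "\<beta> > 0"
    by (simp add: \<beta>_def)
  have vol: "measure lborel (cball (0::'a) r) = \<beta> * r ^ d" if "r \<ge> 0" for r
    using that by (simp add: content_cball \<beta>_def d_def)
  \<comment> \<open>The bound with its powers of \<open>R\<close> collected: the first two factors
    depending on \<open>R\<close> tend to 1, and the last one carries all the decay.\<close>
  have "((\<lambda>R. C\<^sup>2 / \<beta> * (((1 + (R + K)\<^sup>2) / R\<^sup>2) powr (\<alpha> / 2) * ((R + K) / R) ^ d * R powr (\<alpha> - real d)))
          \<longlongrightarrow> C\<^sup>2 / \<beta> * (1 powr (\<alpha> / 2) * 1 ^ d * 0)) at_top"
  proof (intro tendsto_intros)
    show "((\<lambda>R::real. (1 + (R + K)\<^sup>2) / R\<^sup>2) \<longlongrightarrow> 1) at_top" "((\<lambda>R::real. (R + K) / R) \<longlongrightarrow> 1) at_top"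
      by real_asymp+
    show "((\<lambda>R. R powr (\<alpha> - real d)) \<longlongrightarrow> 0) at_top"
      using assms by (intro tendsto_neg_powr filterlim_ident) (simp add: d_def)
  qed auto
  then have lim: "((\<lambda>R. C\<^sup>2 / \<beta> * (((1 + (R + K)\<^sup>2) / R\<^sup>2) powr (\<alpha> / 2) * ((R + K) / R) ^ d
      * R powr (\<alpha> - real d))) \<longlongrightarrow> 0) at_top"
    by simp
  show ?thesis
  proof (rule Lim_transform_eventually[OF lim])
    show "\<forall>\<^sub>F R in at_top. C\<^sup>2 / \<beta> * (((1 + (R + K)\<^sup>2) / R\<^sup>2) powr (\<alpha> / 2) * ((R + K) / R) ^ d
        * R powr (\<alpha> - real d)) = (1 + (R + K)\<^sup>2) powr (\<alpha> / 2) * (C / measure lborel (cball (0::'a) R))\<^sup>2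
            * measure lborel (cball (0::'a) (R + K))"
      \<comment> \<open>Here \<open>K\<close> may have either sign; \<open>R \<ge> - K\<close> makes
        the radius \<open>R + K\<close> nonnegative, as the volume formula \<open>vol\<close>
        requires, and \<open>R \<ge> 1\<close> permits division by \<open>R\<close>.\<close>
      using eventually_ge_at_top[of "max 1 (- K)"]
    proof eventually_elim
      case (elim R)
      then have R: "R > 0" "R + K \<ge> 0"
        by auto
      have "(R\<^sup>2) powr (\<alpha> / 2) = R powr \<alpha>"
        using R by (simp add: powr_powr flip: powr_numeral)
      then have p1: "((1 + (R + K)\<^sup>2) / R\<^sup>2) powr (\<alpha> / 2) = (1 + (R + K)\<^sup>2) powr (\<alpha> / 2) / R powr \<alpha>"
        by (simp add: powr_divide)
      have p2: "R powr (\<alpha> - real d) = R powr \<alpha> / R ^ d"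
        using R by (simp add: powr_diff powr_realpow)
      have "R powr \<alpha> > 0"
        using R by simp
      then show ?case
        unfolding p1 p2 using R \<beta>
        by (simp add: vol power_divide power_mult_distrib) (simp add: field_simps power2_eq_square)
    qed
  qed
qed

section \<open>Positivity of the norm and absence of a minimiser\<close>

text \<open>A nonnegative integrand with zero integral vanishes almost everywhere, and the weight is
  strictly positive.\<close>

lemma sobolev_norm_eq_0_imp_AE:
  fixes \<phi> :: "real ^ 'd \<Rightarrow> complex"
  assumes [measurable]: "\<phi> \<in> borel_measurable lebesgue" and "sobolev_norm s \<phi> = 0"
  shows "AE \<xi> in lebesgue. \<phi> \<xi> = 0"
proof -
  have [measurable]: "(japanese_bracket :: real ^ 'd \<Rightarrow> real) \<in> borel_measurable lebesgue"
    unfolding japanese_bracket_def by (rule measurable_completion) measurable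
  have pos: "japanese_bracket \<xi> > 0" for \<xi> :: "real ^ 'd"
    by (simp add: japanese_bracket_def add_pos_nonneg)
  have "(\<integral>\<^sup>+\<xi>. ennreal (japanese_bracket \<xi> powr (2 * s) * (norm (\<phi> \<xi>))\<^sup>2) \<partial>lebesgue) = 0"
    using assms(2) ennsqrt_power2 unfolding sobolev_norm_def by (metis zero_power2)
  then have "AE \<xi> in lebesgue. ennreal (japanese_bracket \<xi> powr (2 * s) * (norm (\<phi> \<xi>))\<^sup>2) = 0"
    by (subst (asm) nn_integral_0_iff_AE) measurable
  then show ?thesis
  proof eventually_elim
    case (elim \<xi>)
    then have "japanese_bracket \<xi> powr (2 * s) * (norm (\<phi> \<xi>))\<^sup>2 \<le> 0"
      by (simp add: ennreal_eq_0_iff)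
    moreover have "japanese_bracket \<xi> powr (2 * s) > 0"
      using pos[of \<xi>] by simp
    ultimately show ?case
      by (simp add: mult_le_0_iff)
  qed
qed

text \<open>Samples are integrals, so a function that vanishes almost everywhere has only zero
  samples.\<close>

lemma admissible_sobolev_norm_nonzero:
  assumes "\<phi> \<in> admissible X Y" "Y \<noteq> 0"
  shows "sobolev_norm s \<phi> \<noteq> 0"
proof
  assume "sobolev_norm s \<phi> = 0"
  moreover have "\<phi> \<in> borel_measurable lebesgue"
    using assms(1) by (simp add: admissible_def L2_functions_def)
  ultimately have "AE \<xi> in lebesgue. \<phi> \<xi> = 0"
    by (rule sobolev_norm_eq_0_imp_AE[rotated])
  then have "sampling X \<phi> $ i = 0" for i
    unfolding sampling_def by (auto intro!: integral_eq_zero_AE elim: eventually_mono)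
  then have "Y = 0"
    using assms(1) by (auto simp: admissible_def vec_eq_iff)
  with assms(2) show False ..
qed

theorem theorem1:
  fixes \<alpha> :: real
    and X :: "'n::finite \<Rightarrow> real ^ 'd::finite"
    and Y :: "real ^ 'n"
  assumes "\<alpha> > 0"
    and "inj X"
    and "Y \<noteq> 0"
    and "\<alpha> < real CARD('d)"
  shows "\<not> (\<exists>\<phi>. is_arg_min (\<lambda>\<phi>. (sobolev_norm (\<alpha> / 2) \<phi>)\<^sup>2) (\<lambda>\<phi>. \<phi> \<in> admissible X Y) \<phi>)"
proof
  assume "\<exists>\<phi>. is_arg_min (\<lambda>\<phi>. (sobolev_norm (\<alpha> / 2) \<phi>)\<^sup>2) (\<lambda>\<phi>. \<phi> \<in> admissible X Y) \<phi>"
  then obtain \<phi> where \<phi>: "\<phi> \<in> admissible X Y"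
    and least: "\<And>\<psi>. \<psi> \<in> admissible X Y \<Longrightarrow> (sobolev_norm (\<alpha> / 2) \<phi>)\<^sup>2 \<le> (sobolev_norm (\<alpha> / 2) \<psi>)\<^sup>2"
    unfolding is_arg_min_def by (auto simp: not_less)
  have "(sobolev_norm (\<alpha> / 2) \<phi>)\<^sup>2 > 0"
    using admissible_sobolev_norm_nonzero[OF \<phi> \<open>Y \<noteq> 0\<close>] by (simp add: zero_less_iff_neq_zero)
  \<comment> \<open>The norm of \<open>\<phi>\<close> might be \<infinity>. A finite positive
    threshold strictly below its square allows comparison with the real-valued bound, which tends to
    0.\<close>
  then obtain e where e: "0 < e" "e < (sobolev_norm (\<alpha> / 2) \<phi>)\<^sup>2"
    using dense by blast
  have "e < top"
    by (rule less_le_trans[OF e(2) top_greatest])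
  then obtain \<epsilon> where \<epsilon>: "0 < \<epsilon>" "ennreal \<epsilon> < (sobolev_norm (\<alpha> / 2) \<phi>)\<^sup>2"
    using e by (cases e) auto
  define C where "C = (\<Sum>i\<in>UNIV. norm (complex_of_real (Y $ i)))"
  obtain K where K: "K \<ge> 0" "\<And>R. R > 0 \<Longrightarrow>
      \<exists>\<psi>. bump (C / measure lborel (cball (0 :: real ^ 'd) R)) (R + K) \<psi> \<and>
           (\<forall>i. inverse_fourier \<psi> (X i) = complex_of_real (Y $ i))"
    using exists_interpolating_bump[OF \<open>inj X\<close>, of "\<lambda>i. complex_of_real (Y $ i)"]
    by (auto simp: C_def)
  \<comment> \<open>\<open>K\<close> and \<open>C\<close> are already fixed, so \<open>R\<close>
    alone can be increased until the interpolant beats the supposed minimiser.\<close>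
  have "\<forall>\<^sub>F R in at_top. R > 0 \<and>
      (1 + (R + K)\<^sup>2) powr (\<alpha> / 2) * (C / measure lborel (cball (0 :: real ^ 'd) R))\<^sup>2
        * measure lborel (cball (0 :: real ^ 'd) (R + K)) < \<epsilon>"
    using assms(4) \<epsilon>(1)
    by (intro eventually_conj eventually_gt_at_top order_tendstoD(2)[OF bump_norm_bound_tendsto_0]) auto
  then obtain R where R: "R > 0"
      "(1 + (R + K)\<^sup>2) powr (\<alpha> / 2) * (C / measure lborel (cball (0 :: real ^ 'd) R))\<^sup>2
        * measure lborel (cball (0 :: real ^ 'd) (R + K)) < \<epsilon>"
    by (auto dest: eventually_happens)
  obtain \<psi> where \<psi>: "bump (C / measure lborel (cball (0 :: real ^ 'd) R)) (R + K) \<psi>"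
      "\<And>i. inverse_fourier \<psi> (X i) = complex_of_real (Y $ i)"
    using K(2)[OF R(1)] by auto
  have "\<psi> \<in> admissible X Y"
    using bump_L1_L2[OF \<psi>(1)] \<psi>(2) sampling_lborel[OF bump_measurable[OF \<psi>(1)], of X]
    by (simp add: admissible_def vec_eq_iff)
  then have "(sobolev_norm (\<alpha> / 2) \<phi>)\<^sup>2 \<le> (sobolev_norm (\<alpha> / 2) \<psi>)\<^sup>2"
    by (rule least)
  also have "\<dots> \<le> ennreal ((1 + (R + K)\<^sup>2) powr (\<alpha> / 2) *
      (C / measure lborel (cball (0 :: real ^ 'd) R))\<^sup>2 * measure lborel (cball (0 :: real ^ 'd) (R + K)))"
    using assms(1) K(1) R(1) by (intro sobolev_norm_bump[OF \<psi>(1)]) auto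
  also have "\<dots> \<le> ennreal \<epsilon>"
    using R(2) by (intro ennreal_leI) simp
  finally show False
    using \<epsilon>(2) by simp
qed

end
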